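(* Let $X$ be an infinite set with $|X|=\aleph_\varepsilon$. Let $\kappa=\aleph_0+|\varepsilon|$. Then there are $\kappa^{\aleph_0}$ conjugacy classes in $\Gamma(X)$, of which two have a connected representative if $\aleph_\varepsilon=\aleph_0$, and none has a connected representative if $\aleph_\varepsilon>\aleph_0$.
   Context: Conjugacy. For a semigroup $S$, $S^1$ is $S$ if $S$ is a monoid, and $S$ with an identity adjoined otherwise. If $S$ has a zero $0$ and $0\ne a\in S$, let $\mathbb{P}(a)=\{g\in S:(ma)g\neq 0\text{ for all }ma\in S^1a\setminus\{0\}\}$, and $\mathbb{P}(0)=\{0\}$; if $S$ has no zero, $\mathbb{P}(a)=S$ for all $a$. Put $\mathbb{P}^1(a)=\mathbb{P}(a)\cup\{1\}$. Then $a\sim_c b$ iff there are $g\in\mathbb{P}^1(a)$, $h\in\mathbb{P}^1(b)$ with $ag=gb$ and $bh=ha$. This is an equivalence relation; its classes are the conjugacy classes of $S$. $\Gamma(X)$ is the semigroup of all injective maps $X\to X$ (full transformations), written on the right and composed left to right. $\alpha\in\Gamma(X)$ is connected if for all $x,y\in X$ there are integers $k,m\ge0$ with $x\alpha^k=y\alpha^m$ ($\alpha^0=\mathrm{id}_X$). Here $\varepsilon$ is an ordinal and $|\varepsilon|$ its cardinality. *)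

theory Defs
  imports Main "HOL-Library.FuncSet"
begin

unbundle cardinal_syntax

section \<open>Semigroups and conjugacy\<close>

text \<open>
  A semigroup is given by its carrier \<open>S\<close> and its multiplication \<open>mul\<close>.
\<close>

definition is_zero :: "'s set \<Rightarrow> ('s \<Rightarrow> 's \<Rightarrow> 's) \<Rightarrow> 's \<Rightarrow> bool" where
  "is_zero S mul z \<longleftrightarrow> z \<in> S \<and> (\<forall>s\<in>S. mul z s = z \<and> mul s z = z)"

definition is_identity :: "'s set \<Rightarrow> ('s \<Rightarrow> 's \<Rightarrow> 's) \<Rightarrow> 's \<Rightarrow> bool" where
  "is_identity S mul e \<longleftrightarrow> e \<in> S \<and> (\<forall>s\<in>S. mul e s = s \<and> mul s e = s)"

text \<open>
  \<open>S\<^sup>1\<close> lives on the type \<^typ>\<open>'s option\<close>: \<open>Some\<close> embeds \<open>S\<close>, and \<open>None\<close> is the adjoined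
  identity, which belongs to the carrier only if \<open>S\<close> has no identity of its own.
\<close>

definition S1 :: "'s set \<Rightarrow> ('s \<Rightarrow> 's \<Rightarrow> 's) \<Rightarrow> 's option set" where
  "S1 S mul = (if \<exists>e. is_identity S mul e then Some ` S else insert None (Some ` S))"

definition one1 :: "'s set \<Rightarrow> ('s \<Rightarrow> 's \<Rightarrow> 's) \<Rightarrow> 's option" where
  "one1 S mul =
     (if \<exists>e. is_identity S mul e then Some (THE e. is_identity S mul e) else None)"

fun mul1 :: "('s \<Rightarrow> 's \<Rightarrow> 's) \<Rightarrow> 's option \<Rightarrow> 's option \<Rightarrow> 's option" where
  "mul1 mul None y = y"
| "mul1 mul (Some x) None = Some x"
| "mul1 mul (Some x) (Some y) = Some (mul x y)"

text \<open>
  The set \<open>\<bbbP>(a)\<close> for \<open>a \<in> S\<close>. Here \<open>t\<close> ranges over \<open>S\<^sup>1a\<close> without \<open>0\<close>.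
\<close>

definition PP :: "'s set \<Rightarrow> ('s \<Rightarrow> 's \<Rightarrow> 's) \<Rightarrow> 's \<Rightarrow> 's set" where
  "PP S mul a =
     (if \<exists>z. is_zero S mul z then
        (let z = (THE z. is_zero S mul z) in
         if a = z then {z}
         else {g \<in> S. \<forall>t \<in> {mul1 mul m (Some a) | m. m \<in> S1 S mul} - {Some z}.
                        mul1 mul t (Some g) \<noteq> Some z})
      else S)"

definition PP1 :: "'s set \<Rightarrow> ('s \<Rightarrow> 's \<Rightarrow> 's) \<Rightarrow> 's \<Rightarrow> 's option set" where
  "PP1 S mul a = Some ` PP S mul a \<union> {one1 S mul}"

definition conj_rel :: "'s set \<Rightarrow> ('s \<Rightarrow> 's \<Rightarrow> 's) \<Rightarrow> 's rel" where
  "conj_rel S mul =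
     {(a, b). a \<in> S \<and> b \<in> S \<and>
        (\<exists>g \<in> PP1 S mul a. \<exists>h \<in> PP1 S mul b.
           mul1 mul (Some a) g = mul1 mul g (Some b) \<and>
           mul1 mul (Some b) h = mul1 mul h (Some a))}"

definition conj_classes :: "'s set \<Rightarrow> ('s \<Rightarrow> 's \<Rightarrow> 's) \<Rightarrow> 's set set" where
  "conj_classes S mul = S // conj_rel S mul"


section \<open>The semigroup of injective maps\<close>

text \<open>
  As usual, maps on the set \<open>X\<close> are made extensional. Maps act on the right, so the product
  \<open>\<alpha>\<beta>\<close> applies \<open>\<alpha>\<close> first.
\<close>

definition Gamma :: "'a set \<Rightarrow> ('a \<Rightarrow> 'a) set" where
  "Gamma X = {\<alpha> \<in> X \<rightarrow>\<^sub>E X. inj_on \<alpha> X}"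

definition Gamma_mul :: "'a set \<Rightarrow> ('a \<Rightarrow> 'a) \<Rightarrow> ('a \<Rightarrow> 'a) \<Rightarrow> ('a \<Rightarrow> 'a)" where
  "Gamma_mul X \<alpha> \<beta> = compose X \<beta> \<alpha>"

definition connected_map :: "'a set \<Rightarrow> ('a \<Rightarrow> 'a) \<Rightarrow> bool" where
  "connected_map X \<alpha> \<longleftrightarrow> (\<forall>x\<in>X. \<forall>y\<in>X. \<exists>k m :: nat. (\<alpha> ^^ k) x = (\<alpha> ^^ m) y)"


section \<open>Alephs\<close>

text \<open>
  An ordinal \<open>\<epsilon>\<close> is represented by a well-order \<open>r\<close> of type \<open>\<epsilon>\<close>; the ordinals \<open>\<beta> < \<epsilon>\<close> correspond
  to the elements of \<^term>\<open>Field r\<close>. The alephs are defined by transfinite recursion: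
  \<open>\<aleph>\<^sub>\<beta>\<close> is the least infinite cardinal greater than \<open>\<aleph>\<^sub>\<gamma>\<close> for all \<open>\<gamma> < \<beta>\<close>.
  Competing cardinals need only be taken from the type of \<open>k\<close>, because a cardinal smaller
  than \<open>k\<close> is always realised there. For the same reason the \<open>\<aleph>\<^sub>\<beta>\<close> with \<open>\<beta> < \<epsilon>\<close> can be
  realised on the type of \<open>\<aleph>\<^sub>\<epsilon>\<close>.
\<close>

definition least_infinite_cardinal_above :: "'a rel set \<Rightarrow> 'a rel \<Rightarrow> bool" where
  "least_infinite_cardinal_above C k \<longleftrightarrow>
     Cinfinite k \<and> (\<forall>c\<in>C. c <o k) \<and>
     (\<forall>k' :: 'a rel. Cinfinite k' \<and> (\<forall>c\<in>C. c <o k') \<longrightarrow> k \<le>o k')"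

definition is_aleph :: "'e rel \<Rightarrow> 'a rel \<Rightarrow> bool" where
  "is_aleph r k \<longleftrightarrow>
     (\<exists>al :: 'e \<Rightarrow> 'a rel.
        (\<forall>i\<in>Field r. least_infinite_cardinal_above (al ` underS r i) (al i)) \<and>
        least_infinite_cardinal_above (al ` Field r) k)"

end

theory Submission
  imports Defs "HOL-Library.Nat_Bijection"
begin

text \<open>
  Since \<open>\<Gamma>(X)\<close> is a monoid without zero, \<open>a\<close> and \<open>b\<close> are conjugate iff each of the two maps admits
  an injection of \<open>X\<close> that carries it into the other. Such an injection maps every cycle onto
  a cycle of the same length, so a conjugacy class determines the number of cycles of each length,
  and conversely maps with equally many rays, double rays and cycles of each length are conjugate.
  The cardinals at most \<open>\<aleph>\<^sub>\<epsilon>\<close> number \<open>\<kappa> = \<aleph>\<^sub>0 + |\<epsilon>|\<close>, so there are at most \<open>\<kappa>\<close> to the \<open>\<aleph>\<^sub>0\<close> classes;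
  every sequence of cycle numbers is realised, because adding \<open>|X|\<close> rays fills up the set.
  A connected map of an infinite set is a single ray or a single double ray, and a double ray
  does not embed into a ray.
\<close>

subsection \<open>Conjugacy in the semigroup of injective maps\<close>

text \<open>With arguments written on the left, this is the equation \<open>ag = gb\<close> for
  products read from left to right. For infinite \<open>X\<close>, conjugacy turns out to be the
  symmetric part of this preorder on \<open>Gamma X\<close>.\<close>

definition embeds :: "'a set \<Rightarrow> ('a \<Rightarrow> 'a) \<Rightarrow> ('a \<Rightarrow> 'a) \<Rightarrow> bool" where
  "embeds X a b \<longleftrightarrow> (\<exists>g\<in>Gamma X. \<forall>x\<in>X. g (a x) = b (g x))"

section \<open>Iterates of injective maps\<close>

lemma Gamma_mem: "a \<in> Gamma X \<Longrightarrow> x \<in> X \<Longrightarrow> a x \<in> X"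
  by (auto simp: Gamma_def)

lemma Gamma_inj: "a \<in> Gamma X \<Longrightarrow> x \<in> X \<Longrightarrow> y \<in> X \<Longrightarrow> a x = a y \<Longrightarrow> x = y"
  by (auto simp: Gamma_def dest: inj_onD)

lemma Gamma_funpow_mem: "a \<in> Gamma X \<Longrightarrow> x \<in> X \<Longrightarrow> (a ^^ n) x \<in> X"
  by (induction n) (auto intro: Gamma_mem)

lemma Gamma_funpow_inj:
  "a \<in> Gamma X \<Longrightarrow> x \<in> X \<Longrightarrow> y \<in> X \<Longrightarrow> (a ^^ n) x = (a ^^ n) y \<Longrightarrow> x = y"
  by (induction n) (auto dest: Gamma_inj intro: Gamma_funpow_mem)

lemma funpow_add_apply: "(f ^^ (m + n)) x = (f ^^ m) ((f ^^ n) x)"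
  by (simp add: funpow_add)

lemma Gamma_funpow_cancel:
  assumes "a \<in> Gamma X" "x \<in> X" "y \<in> X" "(a ^^ (m + i)) x = (a ^^ (m + j)) y"
  shows "(a ^^ i) x = (a ^^ j) y"
  using assms by (metis Gamma_funpow_inj Gamma_funpow_mem funpow_add_apply)

lemma intertwine_funpow:
  assumes "\<And>x. x \<in> X \<Longrightarrow> a x \<in> X" "\<And>x. x \<in> X \<Longrightarrow> g (a x) = b (g x)" "x \<in> X"
  shows "g ((a ^^ n) x) = (b ^^ n) (g x)"
proof -
  have "(a ^^ n) x \<in> X \<and> g ((a ^^ n) x) = (b ^^ n) (g x)"
    by (induction n) (use assms in auto)
  then show ?thesis by simp
qed

section \<open>The monoid of injective maps and its conjugacy relation\<close>

lemma Gamma_restrict_id: "restrict id X \<in> Gamma X"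
  by (auto simp: Gamma_def inj_on_def)

lemma Gamma_identity: "is_identity (Gamma X) (Gamma_mul X) (restrict id X)"
proof -
  have "compose X s (restrict id X) = s \<and> compose X (restrict id X) s = s" if "s \<in> Gamma X" for s
  proof -
    have "s \<in> extensional X" "\<And>x. x \<in> X \<Longrightarrow> s x \<in> X"
      using that by (auto simp: Gamma_def PiE_def)
    then show ?thesis
      by (auto simp: compose_def fun_eq_iff extensional_def)
  qed
  then show ?thesis by (auto simp: is_identity_def Gamma_mul_def Gamma_restrict_id)
qed

text \<open>A zero would absorb a transposition applied before it, so it would take the same value
  at two distinct points.\<close>

lemma Gamma_no_zero:
  assumes "infinite X"
  shows "\<not> is_zero (Gamma X) (Gamma_mul X) z"
proof
  assume z: "is_zero (Gamma X) (Gamma_mul X) z"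
  obtain x where x: "x \<in> X" using assms by fastforce
  obtain y where y: "y \<in> X" "y \<noteq> x"
    using assms by (metis finite.emptyI finite.insertI finite_subset insertI1 subsetI)
  let ?s = "restrict (id (x := y, y := x)) X"
  have s: "?s \<in> Gamma X" using x y by (auto simp: Gamma_def inj_on_def)
  have zG: "z \<in> Gamma X" using z by (simp add: is_zero_def)
  have "compose X z ?s = z" using z s by (simp add: is_zero_def Gamma_mul_def)
  then have "z (?s x) = z x" using x by (metis compose_eq)
  then show False using x y Gamma_inj[OF zG] by auto
qed

text \<open>Without a zero, every \<open>PP\<close> is the whole semigroup, which already contains
  the identity. The conditions on \<open>g\<close> and \<open>h\<close> thus reduce to membership in
  \<open>Gamma X\<close> and the two equations.\<close>

lemma conj_rel_Gamma_iff:
  assumes "infinite X"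
  shows "(a, b) \<in> conj_rel (Gamma X) (Gamma_mul X) \<longleftrightarrow>
    a \<in> Gamma X \<and> b \<in> Gamma X \<and> embeds X a b \<and> embeds X b a"
proof -
  let ?e = "restrict id X"
  \<comment> \<open>The identity is unique, so the description operator in \<open>one1\<close>
    returns \<open>restrict id X\<close>.\<close>
  have uniq: "e = ?e" if "is_identity (Gamma X) (Gamma_mul X) e" for e
  proof -
    have "Gamma_mul X e ?e = ?e" "Gamma_mul X e ?e = e"
      using that Gamma_identity[of X] unfolding is_identity_def by blast+
    then show ?thesis by simp
  qed
  then have "(THE e. is_identity (Gamma X) (Gamma_mul X) e) = ?e"
    using Gamma_identity[of X] by (intro the_equality)
  then have one: "one1 (Gamma X) (Gamma_mul X) = Some ?e"
    using Gamma_identity[of X] by (auto simp: one1_def)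
  have PP1: "PP1 (Gamma X) (Gamma_mul X) c = Some ` Gamma X" for c
    using Gamma_no_zero[OF assms] Gamma_restrict_id[of X] by (auto simp: PP1_def PP_def one)
  have eq: "Gamma_mul X c g = Gamma_mul X g d \<longleftrightarrow> (\<forall>x\<in>X. g (c x) = d (g x))" for c g d
    by (auto simp: Gamma_mul_def compose_def restrict_def fun_eq_iff)
  show ?thesis
    unfolding conj_rel_def embeds_def by (auto simp: PP1 eq)
qed

lemma embeds_refl: "a \<in> Gamma X \<Longrightarrow> embeds X a a"
  unfolding embeds_def using Gamma_restrict_id
  by (intro bexI[of _ "restrict id X"]) (auto simp: Gamma_mem)

lemma embeds_trans:
  assumes "a \<in> Gamma X" "embeds X a b" "embeds X b c"
  shows "embeds X a c"
proof -
  obtain g h where g: "g \<in> Gamma X" "\<forall>x\<in>X. g (a x) = b (g x)"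
    and h: "h \<in> Gamma X" "\<forall>x\<in>X. h (b x) = c (h x)"
    using assms unfolding embeds_def by blast
  have "compose X h g \<in> Gamma X"
    using g(1) h(1) by (auto simp: Gamma_def compose_def inj_on_def) (meson PiE_mem)+
  moreover have "compose X h g (a x) = c (compose X h g x)" if "x \<in> X" for x
    using that g h assms(1) by (simp add: compose_eq Gamma_mem)
  ultimately show ?thesis unfolding embeds_def by blast
qed

lemma equiv_conj_rel_Gamma:
  assumes "infinite X"
  shows "equiv (Gamma X) (conj_rel (Gamma X) (Gamma_mul X))"
proof (rule equivI)
  show "conj_rel (Gamma X) (Gamma_mul X) \<subseteq> Gamma X \<times> Gamma X"
    by (auto simp: conj_rel_def)
  show "refl_on (Gamma X) (conj_rel (Gamma X) (Gamma_mul X))"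
    by (auto simp: refl_on_def conj_rel_Gamma_iff[OF assms] embeds_refl)
  show "sym (conj_rel (Gamma X) (Gamma_mul X))"
    by (auto simp: sym_def conj_rel_Gamma_iff[OF assms])
  show "trans (conj_rel (Gamma X) (Gamma_mul X))"
    by (rule transI) (auto simp: conj_rel_Gamma_iff[OF assms] intro: embeds_trans)
qed

text \<open>Conjugating with a bijection moves a map from a convenient model set \<open>Y\<close> to
  \<open>X\<close>. The maps with prescribed cycles and the two connected maps are built in this
  way.\<close>

lemma Gamma_transfer:
  fixes X :: "'a set" and Y :: "'b set"
  assumes "|X| =o |Y|" "f \<in> Y \<rightarrow> Y" "inj_on f Y"
  obtains a \<beta> where "a \<in> Gamma X" "bij_betw \<beta> X Y" "\<And>x. x \<in> X \<Longrightarrow> \<beta> (a x) = f (\<beta> x)"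
proof -
  obtain \<beta> where \<beta>: "bij_betw \<beta> X Y" using assms(1) card_of_ordIso by blast
  let ?a = "restrict (\<lambda>x. inv_into X \<beta> (f (\<beta> x))) X"
  have eq: "\<beta> (?a x) = f (\<beta> x)" "?a x \<in> X" if "x \<in> X" for x
  proof -
    have "f (\<beta> x) \<in> \<beta> ` X" using \<beta> assms(2) that by (auto simp: bij_betw_def)
    then show "\<beta> (?a x) = f (\<beta> x)" "?a x \<in> X"
      using that by (auto simp: f_inv_into_f inv_into_into)
  qed
  have "inj_on ?a X"
  proof (rule inj_onI)
    fix x y assume xy: "x \<in> X" "y \<in> X" "?a x = ?a y"
    then have "f (\<beta> x) = f (\<beta> y)" using eq(1)[of x] eq(1)[of y] by simp
    then show "x = y" using \<beta> assms(3) xy by (auto simp: bij_betw_def inj_on_def)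
  qed
  then have "?a \<in> Gamma X" using eq(2) by (auto simp: Gamma_def)
  then show ?thesis using that \<beta> eq(1) by blast
qed


subsection \<open>Orbits\<close>

text \<open>Two points share an orbit when their forward iterates meet; the orbits are the connected
  components of the functional graph.\<close>

definition same_orbit :: "('a \<Rightarrow> 'a) \<Rightarrow> 'a \<Rightarrow> 'a \<Rightarrow> bool" where
  "same_orbit a x y \<longleftrightarrow> (\<exists>k m. (a ^^ k) x = (a ^^ m) y)"

definition periodic_points :: "'a set \<Rightarrow> ('a \<Rightarrow> 'a) \<Rightarrow> nat \<Rightarrow> 'a set" where
  "periodic_points X a n =
    {x \<in> X. 0 < n \<and> (a ^^ n) x = x \<and> (\<forall>m. 0 < m \<and> m < n \<longrightarrow> (a ^^ m) x \<noteq> x)}"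

text \<open>
  An orbit of an injective map is a ray, a double ray or a cycle. The strata are, in this order,
  the initial points of the rays, the points on the double rays, and for every \<open>n \<ge> 1\<close> the points
  on the \<open>n\<close>-cycles.
\<close>

definition stratum :: "'a set \<Rightarrow> ('a \<Rightarrow> 'a) \<Rightarrow> nat \<Rightarrow> 'a set" where
  "stratum X a k =
    (if k = 0 then X - a ` X
     else if k = 1 then {x. (\<forall>p>0. (a ^^ p) x \<noteq> x) \<and> (\<forall>m. x \<in> (a ^^ m) ` X)}
     else periodic_points X a (k - 1))"

text \<open>The last condition forces the representative of a ray to be its initial point. Then
  \<open>T \<inter> stratum X a k\<close> counts the orbits of the type with index
  \<open>k\<close>.\<close>

definition transversal :: "'a set \<Rightarrow> ('a \<Rightarrow> 'a) \<Rightarrow> 'a set \<Rightarrow> bool" where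
  "transversal X a T \<longleftrightarrow> T \<subseteq> X \<and> (\<forall>z\<in>X. \<exists>t\<in>T. same_orbit a z t) \<and>
    (\<forall>t\<in>T. \<forall>u\<in>T. same_orbit a t u \<longrightarrow> t = u) \<and> T \<subseteq> (\<Union>k. stratum X a k)"

section \<open>Orbit types and orbit representatives\<close>

lemma same_orbit_refl: "same_orbit a x x"
  unfolding same_orbit_def by blast

lemma same_orbit_sym: "same_orbit a x y \<Longrightarrow> same_orbit a y x"
  unfolding same_orbit_def by (elim exE) (metis (no_types))

lemma same_orbit_trans:
  assumes "same_orbit a x y" "same_orbit a y z"
  shows "same_orbit a x z"
proof -
  obtain k m k' m' where "(a ^^ k) x = (a ^^ m) y" "(a ^^ k') y = (a ^^ m') z"
    using assms unfolding same_orbit_def by blast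
  then have "(a ^^ (k' + k)) x = (a ^^ (m + m')) z"
    by (metis add.commute funpow_add_apply)
  then show ?thesis unfolding same_orbit_def by blast
qed

lemma stratum_subset: "stratum X a k \<subseteq> X"
proof
  fix x assume x: "x \<in> stratum X a k"
  show "x \<in> X"
  proof (cases "k = 1")
    case True
    then have "\<forall>m. x \<in> (a ^^ m) ` X" using x by (simp add: stratum_def)
    \<comment> \<open>The double ray stratum lies in \<open>X\<close> only implicitly, through the
      exponent 0.\<close>
    then have "x \<in> (a ^^ 0) ` X" by blast
    then show ?thesis by simp
  qed (use x in \<open>auto simp: stratum_def periodic_points_def split: if_splits\<close>)
qed

lemma initial_not_periodic:
  assumes "a \<in> Gamma X" "x \<in> X - a ` X" "0 < p"
  shows "(a ^^ p) x \<noteq> x"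
proof
  assume "(a ^^ p) x = x"
  then have "x = a ((a ^^ (p - 1)) x)" using assms(3) by (metis Suc_diff_1 comp_apply funpow.simps(2))
  then show False using assms Gamma_funpow_mem[OF assms(1)] by blast
qed

text \<open>Initial points have no preimage, neither they nor double ray points are periodic, and
  the period of a cycle point is its least one. So a point determines the index of its
  stratum.\<close>

lemma stratum_disjoint:
  assumes "a \<in> Gamma X" "x \<in> stratum X a j" "x \<in> stratum X a k"
  shows "j = k"
proof (rule ccontr)
  have *: False if "x \<in> stratum X a i" "x \<in> stratum X a l" "i < l" for i l
  proof (cases "l = 1")
    case True
    then have "x \<in> X - a ` X" "x \<in> (a ^^ 1) ` X"
      using that by (auto simp: stratum_def simp del: funpow.simps)
    then show False by auto
  next
    case False
    then have l: "l - 1 > 0" "(a ^^ (l - 1)) x = x"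
      "\<And>m. 0 < m \<Longrightarrow> m < l - 1 \<Longrightarrow> (a ^^ m) x \<noteq> x"
      using that by (auto simp: stratum_def periodic_points_def)
    consider "i = 0" | "i = 1" | "i > 1" by linarith
    then show False
    proof cases
      case 1
      then show False using initial_not_periodic[OF assms(1)] l that by (auto simp: stratum_def)
    next
      case 2
      then show False using l that by (auto simp: stratum_def)
    next
      case 3
      then show False using l(3)[of "i - 1"] that by (auto simp: stratum_def periodic_points_def)
    qed
  qed
  assume "j \<noteq> k"
  then show False using *[of j k] *[of k j] assms by linarith
qed

text \<open>A point that is neither periodic nor has ancestors of every order is traced back until
  no preimage is left, which gives an initial point.\<close>

lemma orbit_meets_stratum:
  assumes "a \<in> Gamma X" "z \<in> X"
  shows "\<exists>y\<in>X. same_orbit a y z \<and> (\<exists>k. y \<in> stratum X a k)"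
proof (cases "\<exists>p>0. (a ^^ p) z = z")
  case True
  define p where "p = (LEAST p. 0 < p \<and> (a ^^ p) z = z)"
  have "0 < p \<and> (a ^^ p) z = z" unfolding p_def by (rule LeastI_ex) (use True in auto)
  moreover have "(a ^^ m) z \<noteq> z" if "0 < m" "m < p" for m
    using not_less_Least[of m "\<lambda>p. 0 < p \<and> (a ^^ p) z = z"] that unfolding p_def by blast
  \<comment> \<open>Stratum \<open>k\<close> with \<open>k > 1\<close> consists of points of period
    \<open>k - 1\<close>, hence the successor.\<close>
  ultimately have "z \<in> stratum X a (Suc p)"
    using assms by (auto simp: stratum_def periodic_points_def)
  then show ?thesis using assms(2) same_orbit_refl[of a z] by (intro bexI[of _ z]) auto
next
  case np: False
  show ?thesis
  proof (cases "\<forall>m. z \<in> (a ^^ m) ` X")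
    case True
    moreover have "\<forall>p>0. (a ^^ p) z \<noteq> z" using np by blast
    ultimately have "z \<in> stratum X a 1" by (simp add: stratum_def)
    then show ?thesis using assms(2) same_orbit_refl[of a z] by (intro bexI[of _ z]) auto
  next
    case False
    \<comment> \<open>Since \<open>m\<close> is the least number of steps that cannot be traced
      back, \<open>m - 1\<close> steps lead to some \<open>w\<close>, and a preimage of
      \<open>w\<close> would allow \<open>m\<close> steps.\<close>
    define m where "m = (LEAST m. z \<notin> (a ^^ m) ` X)"
    have m: "z \<notin> (a ^^ m) ` X" unfolding m_def by (rule LeastI_ex) (use False in auto)
    have "m \<noteq> 0" using m assms(2) by (metis funpow_0 image_eqI)
    then obtain n where n: "m = Suc n" by (cases m) auto
    then have "z \<in> (a ^^ n) ` X"
      using not_less_Least[of n "\<lambda>m. z \<notin> (a ^^ m) ` X"] unfolding m_def by auto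
    then obtain w where w: "w \<in> X" "z = (a ^^ n) w" by blast
    have "w \<notin> a ` X"
    proof
      assume "w \<in> a ` X"
      then obtain v where "v \<in> X" "w = a v" by blast
      then have "z = (a ^^ m) v" using w n by (simp add: funpow_swap1)
      then show False using m \<open>v \<in> X\<close> by blast
    qed
    then have "w \<in> stratum X a 0" using w by (auto simp: stratum_def)
    moreover have "same_orbit a w z"
      unfolding same_orbit_def using w by (metis funpow_0)
    ultimately show ?thesis using w by blast
  qed
qed

lemma transversal_exists:
  assumes "a \<in> Gamma X"
  shows "\<exists>T. transversal X a T"
proof -
  define P where "P z y \<longleftrightarrow> y \<in> X \<and> same_orbit a y z \<and> (\<exists>k. y \<in> stratum X a k)" for z y
  define r where "r z = (SOME y. P z y)" for z
  have r: "P z (r z)" if "z \<in> X" for z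
    unfolding r_def by (rule someI_ex) (use orbit_meets_stratum[OF assms that] in \<open>auto simp: P_def\<close>)
  \<comment> \<open>Points of one orbit define the same predicate \<open>P z\<close>, so the choice
    operator gives them the same representative.\<close>
  have eq: "r z = r z'" if "same_orbit a z z'" for z z'
  proof -
    have "P z = P z'"
      unfolding P_def using that by (auto simp: fun_eq_iff intro: same_orbit_trans same_orbit_sym)
    then show ?thesis by (simp add: r_def)
  qed
  have "transversal X a (r ` X)"
    unfolding transversal_def
  proof (intro conjI ballI impI)
    fix t u assume tu: "t \<in> r ` X" "u \<in> r ` X" "same_orbit a t u"
    then obtain z z' where z: "z \<in> X" "t = r z" "z' \<in> X" "u = r z'" by blast
    then have "same_orbit a z t" "same_orbit a u z'"
      using r by (auto simp: P_def intro: same_orbit_sym)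
    then have "same_orbit a z z'" using tu(3) same_orbit_trans by metis
    then show "t = u" using eq z by simp
  qed (use r same_orbit_sym in \<open>fastforce simp: P_def\<close>)+
  then show ?thesis by blast
qed

section \<open>Extending maps of orbit representatives to embeddings\<close>

text \<open>
  Sending \<open>x\<close> to \<open>y\<close> extends to an injection of the orbit of \<open>x\<close> into that of \<open>y\<close> commuting with
  the maps: the point \<open>z\<close> with \<open>z a\<^sup>m = x a\<^sup>k\<close> goes to the point \<open>w\<close> with \<open>w b\<^sup>m = y b\<^sup>k\<close>.
\<close>

definition compatible :: "'a set \<Rightarrow> ('a \<Rightarrow> 'a) \<Rightarrow> ('a \<Rightarrow> 'a) \<Rightarrow> 'a \<Rightarrow> 'a \<Rightarrow> bool" where
  "compatible X a b x y \<longleftrightarrow>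
    (\<forall>p q. (a ^^ p) x = (a ^^ q) x \<longleftrightarrow> (b ^^ p) y = (b ^^ q) y) \<and>
    (\<forall>k m. \<forall>z\<in>X. (a ^^ m) z = (a ^^ k) x \<longrightarrow> (\<exists>w\<in>X. (b ^^ m) w = (b ^^ k) y))"

lemma aperiodic_funpow_eq_iff:
  assumes "a \<in> Gamma X" "x \<in> X" "\<And>p. 0 < p \<Longrightarrow> (a ^^ p) x \<noteq> x"
  shows "(a ^^ p) x = (a ^^ q) x \<longleftrightarrow> p = q"
proof -
  have "(a ^^ p) x \<noteq> (a ^^ q) x" if "p < q" for p q
  proof
    assume "(a ^^ p) x = (a ^^ q) x"
    then have "(a ^^ 0) x = (a ^^ (q - p)) x"
      using Gamma_funpow_cancel[OF assms(1,2,2), of p 0 "q - p"] that by simp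
    then show False using assms(3)[of "q - p"] that by simp
  qed
  then show ?thesis by (metis linorder_neqE_nat)
qed

lemma periodic_funpow_eq_iff:
  assumes "a \<in> Gamma X" "x \<in> periodic_points X a n"
  shows "(a ^^ p) x = (a ^^ q) x \<longleftrightarrow> p mod n = q mod n"
proof -
  have x: "x \<in> X" "0 < n" "(a ^^ n) x = x" "\<And>m. 0 < m \<Longrightarrow> m < n \<Longrightarrow> (a ^^ m) x \<noteq> x"
    using assms(2) by (auto simp: periodic_points_def)
  have ne: "(a ^^ p) x \<noteq> (a ^^ q) x" if "p < q" "q < n" for p q
  proof
    assume "(a ^^ p) x = (a ^^ q) x"
    then have "(a ^^ 0) x = (a ^^ (q - p)) x"
      using Gamma_funpow_cancel[OF assms(1) x(1,1), of p 0 "q - p"] that by simp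
    then show False using x(4)[of "q - p"] that by (simp add: less_imp_diff_less)
  qed
  have "(a ^^ p) x = (a ^^ (p mod n)) x" for p using funpow_mod_eq[OF x(3)] by simp
  moreover have "p mod n < n" "q mod n < n" using x(2) by auto
  ultimately show ?thesis using ne by (metis linorder_neqE_nat)
qed

text \<open>Both points are aperiodic or have the same period, which settles the first condition.
  For the second, \<open>y\<close> can be traced back without bound on double rays and cycles, while
  on rays no point precedes \<open>x\<close>.\<close>

lemma compatible_stratum:
  assumes a: "a \<in> Gamma X" and b: "b \<in> Gamma X"
    and x: "x \<in> stratum X a k" and y: "y \<in> stratum X b k"
  shows "compatible X a b x y"
proof -
  have xX: "x \<in> X" and yX: "y \<in> X" using x y by (auto dest: stratum_subset[THEN subsetD])
  consider "k = 0" | "k = 1" | "k > 1" by linarith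
  then show ?thesis
  proof cases
    case 1
    then have x0: "x \<in> X - a ` X" and y0: "y \<in> X - b ` X" using x y by (auto simp: stratum_def)
    have "\<exists>w\<in>X. (b ^^ m) w = (b ^^ k) y" if z: "z \<in> X" "(a ^^ m) z = (a ^^ k) x" for z k m
    proof (cases "m \<le> k")
      case True
      then have "(b ^^ m) ((b ^^ (k - m)) y) = (b ^^ k) y" by (simp flip: funpow_add_apply)
      then show ?thesis using Gamma_funpow_mem[OF b yX] by blast
    next
      case False
      \<comment> \<open>For \<open>m > k\<close>, cancelling \<open>k\<close> steps would make
        \<open>z\<close> a proper ancestor of the initial point \<open>x\<close>.\<close>
      then have "(a ^^ (k + Suc (m - k - 1))) z = (a ^^ (k + 0)) x" using z by simp
      then have "(a ^^ Suc (m - k - 1)) z = (a ^^ 0) x" using Gamma_funpow_cancel[OF a z(1) xX] by blast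
      then have "a ((a ^^ (m - k - 1)) z) = x" by simp
      then show ?thesis using x0 Gamma_funpow_mem[OF a z(1)] by blast
    qed
    then show ?thesis unfolding compatible_def
      using aperiodic_funpow_eq_iff[OF a xX initial_not_periodic[OF a x0]]
        aperiodic_funpow_eq_iff[OF b yX initial_not_periodic[OF b y0]] by auto
  next
    case 2
    then have x1: "\<And>p. 0 < p \<Longrightarrow> (a ^^ p) x \<noteq> x"
      and y1: "\<And>p. 0 < p \<Longrightarrow> (b ^^ p) y \<noteq> y" and yb: "\<And>m. y \<in> (b ^^ m) ` X"
      using x y by (auto simp: stratum_def)
    have "\<exists>w\<in>X. (b ^^ m) w = (b ^^ k) y" for k m
    proof -
      obtain v where "v \<in> X" "y = (b ^^ m) v" using yb by blast
      then have "(b ^^ m) ((b ^^ k) v) = (b ^^ k) y"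
        by (metis add.commute funpow_add_apply)
      then show ?thesis using Gamma_funpow_mem[OF b \<open>v \<in> X\<close>] by blast
    qed
    then show ?thesis unfolding compatible_def
      using aperiodic_funpow_eq_iff[OF a xX x1] aperiodic_funpow_eq_iff[OF b yX y1] by auto
  next
    case 3
    let ?n = "k - 1"
    have xp: "x \<in> periodic_points X a ?n" and yp: "y \<in> periodic_points X b ?n"
      using 3 x y by (auto simp: stratum_def)
    have "\<exists>w\<in>X. (b ^^ m) w = (b ^^ k') y" for k' m
    proof -
      \<comment> \<open>On a cycle of length \<open>?n\<close>, going back \<open>m\<close> steps is
        going forward \<open>m * (?n - 1)\<close> steps.\<close>
      have "(b ^^ m) ((b ^^ (k' + m * (?n - 1))) y) = (b ^^ (m + (k' + m * (?n - 1)))) y"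
        by (simp only: funpow_add_apply)
      also have "m + (k' + m * (?n - 1)) = k' + m * ?n"
        using 3 by (cases "?n") (auto simp: algebra_simps)
      also have "(b ^^ (k' + m * ?n)) y = (b ^^ k') y"
        by (subst periodic_funpow_eq_iff[OF b yp]) simp
      finally show ?thesis using Gamma_funpow_mem[OF b yX] by blast
    qed
    then show ?thesis unfolding compatible_def
      using periodic_funpow_eq_iff[OF a xp] periodic_funpow_eq_iff[OF b yp] by auto
  qed
qed

text \<open>Compatibility extends \<phi> over each orbit, and injectivity of \<phi> between
  transversals sends distinct orbits to distinct orbits. The relation \<open>G\<close> collects
  these extensions and is the graph of the embedding.\<close>

lemma embeds_of_transversal_map:
  assumes a: "a \<in> Gamma X" and b: "b \<in> Gamma X"
    and T: "transversal X a T" and U: "transversal X b U"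
    and inj: "inj_on \<phi> T" and im: "\<phi> ` T \<subseteq> U"
    and comp: "\<And>t. t \<in> T \<Longrightarrow> compatible X a b t (\<phi> t)"
  shows "embeds X a b"
proof -
  define G where "G z w \<longleftrightarrow> z \<in> X \<and> w \<in> X \<and>
    (\<exists>t\<in>T. \<exists>k m. (a ^^ m) z = (a ^^ k) t \<and> (b ^^ m) w = (b ^^ k) (\<phi> t))" for z w
  have TX: "T \<subseteq> X" and UX: "U \<subseteq> X" using T U by (auto simp: transversal_def)
  have ex: "\<exists>w. G z w" if z: "z \<in> X" for z
  proof -
    obtain t m k where t: "t \<in> T" "(a ^^ m) z = (a ^^ k) t"
      using T z unfolding transversal_def same_orbit_def by meson
    then obtain w where "w \<in> X" "(b ^^ m) w = (b ^^ k) (\<phi> t)"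
      using comp[OF t(1)] z unfolding compatible_def by blast
    then show ?thesis using z t unfolding G_def by blast
  qed
  \<comment> \<open>Both relations are brought to the common exponent \<open>m + m'\<close>, so that
    two points can be compared through iterates of their representatives.\<close>
  have comb: "(f ^^ (m + m')) z = (f ^^ (m' + k)) t" "(f ^^ (m + m')) z' = (f ^^ (m + k')) t'"
    if "(f ^^ m) z = (f ^^ k) t" "(f ^^ m') z' = (f ^^ k') t'" for f :: "'a \<Rightarrow> 'a" and m m' k k' z z' t t'
    \<comment> \<open>The second claim needs the exponents \<open>m\<close> and \<open>m'\<close> in
      the opposite order.\<close>
    using that funpow_add_apply[of m' m f z] funpow_add_apply[of m m' f z']
    by (simp_all add: funpow_add_apply add.commute[of m' m])
  \<comment> \<open>From left to right this says that \<open>G\<close> is single-valued, from right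
    to left that it is injective.\<close>
  have key: "z = z' \<longleftrightarrow> w = w'" if G1: "G z w" and G2: "G z' w'" for z z' w w'
  proof -
    obtain t k m where 1: "t \<in> T" "(a ^^ m) z = (a ^^ k) t" "(b ^^ m) w = (b ^^ k) (\<phi> t)"
      using G1 unfolding G_def by blast
    obtain t' k' m' where 2: "t' \<in> T" "(a ^^ m') z' = (a ^^ k') t'" "(b ^^ m') w' = (b ^^ k') (\<phi> t')"
      using G2 unfolding G_def by blast
    have X: "z \<in> X" "z' \<in> X" "w \<in> X" "w' \<in> X" using G1 G2 by (auto simp: G_def)
    note ca = comb[OF 1(2) 2(2)] and cb = comb[OF 1(3) 2(3)]
    have tt: "t = t'" if "z = z' \<or> w = w'"
      using that
    proof
      assume "z = z'"
      then have "same_orbit a t t'" using ca unfolding same_orbit_def by metis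
      then show ?thesis using T 1 2 by (auto simp: transversal_def)
    next
      assume "w = w'"
      then have "same_orbit b (\<phi> t) (\<phi> t')" using cb unfolding same_orbit_def by metis
      then have "\<phi> t = \<phi> t'" using U im 1(1) 2(1) unfolding transversal_def by blast
      then show ?thesis using inj 1 2 by (auto dest: inj_onD)
    qed
    have cp: "(a ^^ (m' + k)) t = (a ^^ (m + k')) t \<longleftrightarrow> (b ^^ (m' + k)) (\<phi> t) = (b ^^ (m + k')) (\<phi> t)"
      using comp[OF 1(1)] unfolding compatible_def by blast
    show ?thesis
    proof
      assume "z = z'"
      then have "(b ^^ (m + m')) w = (b ^^ (m + m')) w'" using tt ca cb cp by simp
      then show "w = w'" using Gamma_funpow_inj[OF b X(3,4)] by blast
    next
      assume "w = w'"
      then have "(a ^^ (m + m')) z = (a ^^ (m + m')) z'" using tt ca cb cp by simp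
      then show "z = z'" using Gamma_funpow_inj[OF a X(1,2)] by blast
    qed
  qed
  have step: "G (a z) (b w)" if Gzw: "G z w" for z w
  proof -
    obtain t k m where 1: "t \<in> T" "(a ^^ m) z = (a ^^ k) t" "(b ^^ m) w = (b ^^ k) (\<phi> t)"
      and X: "z \<in> X" "w \<in> X"
      using Gzw unfolding G_def by blast
    have "(a ^^ m) (a z) = (a ^^ Suc k) t" "(b ^^ m) (b w) = (b ^^ Suc k) (\<phi> t)"
      using 1 by (metis comp_apply funpow.simps(2) funpow_swap1)+
    then show ?thesis unfolding G_def using 1(1) X a b by (meson Gamma_mem)
  qed
  define g where "g = restrict (\<lambda>z. SOME w. G z w) X"
  have g: "G z (g z)" if "z \<in> X" for z
    using someI_ex[OF ex[OF that]] that by (simp add: g_def)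
  have "g \<in> Gamma X"
    unfolding Gamma_def
  proof (intro CollectI conjI)
    show "g \<in> X \<rightarrow>\<^sub>E X" using g by (auto simp: g_def G_def)
    show "inj_on g X" using key g by (metis inj_onI)
  qed
  \<comment> \<open>Both \<open>g (a z)\<close> and \<open>b (g z)\<close> are related to
    \<open>a z\<close> by \<open>G\<close>, hence they agree.\<close>
  moreover have "g (a z) = b (g z)" if "z \<in> X" for z
    using key[OF g[OF Gamma_mem[OF a that]] step[OF g[OF that]]] by simp
  ultimately show ?thesis unfolding embeds_def by blast
qed

text \<open>One injection per orbit type is glued to an injection of transversals. The condition is
  only sufficient, since a ray also embeds into a double ray.\<close>

lemma embeds_of_strata_le:
  assumes a: "a \<in> Gamma X" and b: "b \<in> Gamma X"
    and T: "transversal X a T" and U: "transversal X b U"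
    and le: "\<And>k. |T \<inter> stratum X a k| \<le>o |U \<inter> stratum X b k|"
  shows "embeds X a b"
proof -
  have "\<forall>k. \<exists>f. inj_on f (T \<inter> stratum X a k) \<and> f ` (T \<inter> stratum X a k) \<subseteq> U \<inter> stratum X b k"
    using le card_of_ordLeq by blast
  then obtain f where f: "\<And>k. inj_on (f k) (T \<inter> stratum X a k)"
    "\<And>k. f k ` (T \<inter> stratum X a k) \<subseteq> U \<inter> stratum X b k" by metis
  have "\<forall>t\<in>T. \<exists>k. t \<in> stratum X a k" using T unfolding transversal_def by blast
  then obtain \<kappa> where \<kappa>: "\<And>t. t \<in> T \<Longrightarrow> t \<in> stratum X a (\<kappa> t)" by metis
  define \<phi> where "\<phi> t = f (\<kappa> t) t" for t
  have \<phi>: "\<phi> t \<in> U" "\<phi> t \<in> stratum X b (\<kappa> t)" if "t \<in> T" for t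
    using f(2)[of "\<kappa> t"] \<kappa>[OF that] that unfolding \<phi>_def by blast+
  show ?thesis
  proof (rule embeds_of_transversal_map[OF a b T U])
    show "inj_on \<phi> T"
    proof (rule inj_onI)
      fix t u assume tu: "t \<in> T" "u \<in> T" "\<phi> t = \<phi> u"
      \<comment> \<open>The stratum of the common image reveals which of the injections
        \<open>f k\<close> was applied.\<close>
      then have eq: "\<kappa> t = \<kappa> u" using \<phi>(2)[OF tu(1)] \<phi>(2)[OF tu(2)] stratum_disjoint[OF b] by metis
      show "t = u"
        using inj_onD[OF f(1)[of "\<kappa> t"]] tu \<kappa>[OF tu(1)] \<kappa>[OF tu(2)] eq by (simp add: \<phi>_def)
    qed
    show "\<phi> ` T \<subseteq> U" using \<phi> by blast
    show "compatible X a b t (\<phi> t)" if "t \<in> T" for t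
      using compatible_stratum[OF a b \<kappa>[OF that] \<phi>(2)[OF that]] .
  qed
qed

text \<open>An injective intertwiner preserves and reflects the equations
  \<open>(a ^^ m) x = x\<close>, hence exact periods. Used in both directions, this makes the number
  of points of each period a conjugacy invariant.\<close>

lemma embeds_periodic_points:
  assumes "a \<in> Gamma X" "embeds X a b"
  shows "|periodic_points X a n| \<le>o |periodic_points X b n|"
proof -
  obtain g where g: "g \<in> Gamma X" "\<And>x. x \<in> X \<Longrightarrow> g (a x) = b (g x)"
    using assms(2) unfolding embeds_def by blast
  have "(b ^^ m) (g x) = g x \<longleftrightarrow> (a ^^ m) x = x" if "x \<in> X" for x m
    using intertwine_funpow[of X a g b, OF Gamma_mem[OF assms(1)] g(2) that, of m]
      Gamma_inj[OF g(1) Gamma_funpow_mem[OF assms(1) that] that, of m] by auto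
  then have "g ` periodic_points X a n \<subseteq> periodic_points X b n"
    using Gamma_mem[OF g(1)] by (auto simp: periodic_points_def)
  moreover have "inj_on g (periodic_points X a n)"
    using g(1) by (auto simp: Gamma_def periodic_points_def inj_on_def)
  ultimately show ?thesis using card_of_ordLeq by blast
qed


subsection \<open>Sets of cardinality at most an aleph\<close>

lemma card_of_finite_ordLeq_infinite:
  assumes "finite A" "infinite B"
  shows "|A| \<le>o |B|"
  using finite_ordLess_infinite[OF card_of_Well_order[of A] card_of_Well_order[of B]] assms
  by (simp add: Field_card_of ordLess_imp_ordLeq)

text \<open>The alephs are strictly increasing, hence distinct. An infinite \<open>A\<close> with
  \<open>|A| <o |X|\<close> is matched with the first \<open>al i\<close> that is at least
  \<open>|A|\<close>: since \<open>|A|\<close> exceeds all earlier alephs, minimality gives the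
  reverse inequality.\<close>

lemma aleph_classification:
  fixes X :: "'a set" and r :: "'e rel"
  assumes "Well_order r" "is_aleph r |X|"
  obtains al :: "'e \<Rightarrow> 'a rel" where
    "\<And>i. i \<in> Field r \<Longrightarrow> Cinfinite (al i)"
    "\<And>i. i \<in> Field r \<Longrightarrow> al i <o |X|"
    "\<And>i j. i \<in> Field r \<Longrightarrow> j \<in> Field r \<Longrightarrow> al i =o al j \<Longrightarrow> i = j"
    "\<And>A :: 'a set. infinite A \<Longrightarrow> |A| <o |X| \<Longrightarrow> \<exists>i\<in>Field r. |A| =o al i"
proof -
  obtain al :: "'e \<Rightarrow> 'a rel"
    where al: "\<And>i. i \<in> Field r \<Longrightarrow> least_infinite_cardinal_above (al ` underS r i) (al i)"
      and X: "least_infinite_cardinal_above (al ` Field r) |X|"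
    using assms(2) unfolding is_aleph_def by blast
  have cinf: "Cinfinite (al i)" if "i \<in> Field r" for i
    using al[OF that] by (simp add: least_infinite_cardinal_above_def)
  have wo: "Well_order (al i)" if "i \<in> Field r" for i
    using cinf[OF that] by (simp add: card_order_on_def)
  have less: "al i <o |X|" if "i \<in> Field r" for i
    using X that by (simp add: least_infinite_cardinal_above_def)
  have mono: "al i <o al j" if "i \<in> underS r j" for i j
  proof -
    have "j \<in> Field r" using that by (auto simp: underS_def Field_def)
    then show ?thesis using al that by (auto simp: least_infinite_cardinal_above_def)
  qed
  have inj: "i = j" if "i \<in> Field r" "j \<in> Field r" "al i =o al j" for i j
  proof (rule ccontr)
    assume "i \<noteq> j"
    moreover have "Total r" using assms(1) by (simp add: order_on_defs)
    ultimately have "i \<in> underS r j \<or> j \<in> underS r i"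
      using that by (auto simp: total_on_def underS_def)
    then show False
      using mono that(3) not_ordLess_ordIso ordIso_symmetric by blast
  qed
  have surj: "\<exists>i\<in>Field r. |A| =o al i" if A: "infinite A" "|A| <o |X|" for A :: "'a set"
  proof -
    have Ac: "Cinfinite |A|"
      using A(1) by (metis Field_card_of card_of_Card_order cinfinite_def)
    define S where "S = {i \<in> Field r. |A| \<le>o al i}"
    have notS: "al i <o |A|" if "i \<in> Field r" "i \<notin> S" for i
      using that not_ordLeq_iff_ordLess[OF wo[OF that(1)] card_of_Well_order[of A]]
      by (simp add: S_def)
    \<comment> \<open>Otherwise \<open>|A|\<close> would lie above every \<open>al i\<close> and
      minimality of \<open>|X|\<close> would give \<open>|X| \<le>o |A|\<close>.\<close>
    have "S \<noteq> {}"
    proof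
      assume "S = {}"
      then have "\<forall>c\<in>al ` Field r. c <o |A|" using notS by blast
      then have "|X| \<le>o |A|" using X Ac by (simp add: least_infinite_cardinal_above_def)
      then show False using A(2) not_ordLess_ordLeq by blast
    qed
    moreover have "wf (r - Id)" using assms(1) by (simp add: well_order_on_def)
    ultimately obtain i where i: "i \<in> S" "\<And>j. (j, i) \<in> r - Id \<Longrightarrow> j \<notin> S"
      by (metis wfE_min ex_in_conv)
    have iF: "i \<in> Field r" and le: "|A| \<le>o al i" using i(1) by (auto simp: S_def)
    have "\<forall>c\<in>al ` underS r i. c <o |A|"
      using i(2) notS by (auto simp: underS_def intro: FieldI1)
    then have "al i \<le>o |A|"
      using al[OF iF] Ac by (simp add: least_infinite_cardinal_above_def)
    then show ?thesis using le iF ordIso_iff_ordLeq by blast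
  qed
  show ?thesis using that cinf less inj surj by blast
qed

text \<open>This bounds the number of cardinals at most \<open>|X|\<close> from above: each is
  finite, equal to \<open>|X|\<close>, or some \<open>al i\<close>.\<close>

lemma card_codes:
  fixes X :: "'a set" and r :: "'e rel"
  assumes "Well_order r" "is_aleph r |X|"
  obtains c :: "'a set \<Rightarrow> nat + 'e" where
    "\<And>A. A \<subseteq> X \<Longrightarrow> c A \<in> UNIV <+> Field r"
    "\<And>A B. A \<subseteq> X \<Longrightarrow> B \<subseteq> X \<Longrightarrow> c A = c B \<Longrightarrow> |A| =o |B|"
proof -
  obtain al :: "'e \<Rightarrow> 'a rel"
    where al: "\<And>A :: 'a set. infinite A \<Longrightarrow> |A| <o |X| \<Longrightarrow> \<exists>i\<in>Field r. |A| =o al i"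
    using aleph_classification[OF assms] by metis
  define ix where "ix A = (SOME i. i \<in> Field r \<and> |A| =o al i)" for A :: "'a set"
  have ix: "ix A \<in> Field r \<and> |A| =o al (ix A)"
    if "A \<subseteq> X" "infinite A" "\<not> |A| =o |X|" for A
  proof -
    have "|A| <o |X|" using that card_of_mono1 ordLeq_iff_ordLess_or_ordIso by metis
    then show ?thesis unfolding ix_def using someI_ex[of "\<lambda>i. i \<in> Field r \<and> |A| =o al i"] al that
      by blast
  qed
  \<comment> \<open>Finite cardinals are shifted by one to keep \<open>Inl 0\<close> free for
    \<open>|X|\<close> itself, which is none of the \<open>al i\<close>.\<close>
  define c where "c A = (if finite A then Inl (Suc (card A)) else if |A| =o |X| then Inl 0
    else Inr (ix A))" for A :: "'a set"
  have "c A \<in> UNIV <+> Field r" if "A \<subseteq> X" for A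
    using ix[OF that] by (auto simp: c_def)
  moreover have "|A| =o |B|" if AB: "A \<subseteq> X" "B \<subseteq> X" "c A = c B" for A B
  proof (cases "finite A")
    case True
    then have "finite B" "card A = card B" using AB(3) by (auto simp: c_def split: if_splits)
    then show ?thesis using finite_same_card_bij[OF True] card_of_ordIsoI by metis
  next
    case False
    then have B: "infinite B" using AB(3) by (auto simp: c_def split: if_splits)
    show ?thesis
    proof (cases "|A| =o |X|")
      case True
      then have "|B| =o |X|" using AB(3) False B by (auto simp: c_def split: if_splits)
      then show ?thesis using True ordIso_symmetric ordIso_transitive by blast
    next
      case nA: False
      then have nB: "\<not> |B| =o |X|" and "ix A = ix B"
        using AB(3) False B by (auto simp: c_def split: if_splits)
      then have "|A| =o al (ix A)" "|B| =o al (ix A)"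
        using ix[OF AB(1) False nA] ix[OF AB(2) B nB] by auto
      then show ?thesis using ordIso_symmetric ordIso_transitive by blast
    qed
  qed
  ultimately show ?thesis using that by blast
qed

text \<open>This bounds the number of cardinals from below. The factor \<open>{..n}\<close> appears
  because \<open>M u\<close> many cycles of length \<open>n + 1\<close> contain
  \<open>{..n} \<times> M u\<close> many points; it cancels for finite \<open>M u\<close> and is
  absorbed by infinite \<open>M u\<close>.\<close>

lemma card_models:
  fixes X :: "'a set" and r :: "'e rel"
  assumes "infinite X" "Well_order r" "is_aleph r |X|"
  obtains M :: "nat + 'e \<Rightarrow> (nat + 'a) set" where
    "\<And>u. u \<in> UNIV <+> Field r \<Longrightarrow> |M u| \<le>o |X|"
    "\<And>u v n. u \<in> UNIV <+> Field r \<Longrightarrow> v \<in> UNIV <+> Field r \<Longrightarrow>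
      |{..n::nat} \<times> M u| =o |{..n} \<times> M v| \<Longrightarrow> u = v"
proof -
  obtain al :: "'e \<Rightarrow> 'a rel"
    where cinf: "\<And>i. i \<in> Field r \<Longrightarrow> Cinfinite (al i)"
      and less: "\<And>i. i \<in> Field r \<Longrightarrow> al i <o |X|"
      and inj: "\<And>i j. i \<in> Field r \<Longrightarrow> j \<in> Field r \<Longrightarrow> al i =o al j \<Longrightarrow> i = j"
    using aleph_classification[OF assms(2,3)] by metis
  define M :: "nat + 'e \<Rightarrow> (nat + 'a) set"
    where "M u = (case u of Inl m \<Rightarrow> Inl ` {..<m} | Inr i \<Rightarrow> Inr ` Field (al i))" for u
  have Minf: "infinite (M (Inr i))" "|M (Inr i)| =o al i" if "i \<in> Field r" for i
  proof -
    show "infinite (M (Inr i))"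
      using cinf[OF that] by (simp add: M_def cinfinite_def finite_image_iff)
    have "|M (Inr i)| =o |Field (al i)|"
      unfolding M_def sum.case
      by (rule ordIso_symmetric, rule card_of_ordIsoI[of Inr]) (simp add: inj_on_imp_bij_betw)
    then show "|M (Inr i)| =o al i"
      using card_of_Field_ordIso[of "al i"] cinf[OF that] ordIso_transitive by blast
  qed
  have Mn: "|{..n::nat} \<times> M (Inr i)| =o al i" if "i \<in> Field r" for n i
  proof -
    have "|{..n}| \<le>o |M (Inr i)|"
      using Minf(1)[OF that] by (simp add: card_of_finite_ordLeq_infinite)
    then have "|{..n} \<times> M (Inr i)| =o |M (Inr i)|"
      using card_of_Times_infinite[OF Minf(1)[OF that], of "{..n}"] by simp
    then show ?thesis using Minf(2)[OF that] ordIso_transitive by blast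
  qed
  show ?thesis
  proof (rule that[of M])
    fix u assume u: "u \<in> (UNIV :: nat set) <+> Field r"
    show "|M u| \<le>o |X|"
    proof (cases u)
      case (Inl m)
      then show ?thesis
        using assms(1) by (simp add: M_def card_of_finite_ordLeq_infinite)
    next
      case (Inr i)
      then have "i \<in> Field r" using u by auto
      then show ?thesis
        using Inr Minf(2) less ordIso_ordLess_trans ordLess_imp_ordLeq by blast
    qed
  next
    fix u v n assume uv: "u \<in> (UNIV :: nat set) <+> Field r" "v \<in> (UNIV :: nat set) <+> Field r"
      and eq: "|{..n::nat} \<times> M u| =o |{..n} \<times> M v|"
    have fin: "finite ({..n} \<times> M (Inl m))" "card ({..n} \<times> M (Inl m)) = Suc n * m" for m
      by (simp_all add: M_def card_cartesian_product card_image)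
    have infi: "infinite ({..n} \<times> M (Inr i))" if "i \<in> Field r" for i
      using Minf(1)[OF that] by (auto simp: finite_cartesian_product_iff)
    have fin_iff: "finite ({..n} \<times> M u) \<longleftrightarrow> finite ({..n} \<times> M v)"
      using eq card_of_ordIso_finite by blast
    have card_eq: "card ({..n} \<times> M u) = card ({..n} \<times> M v)"
      using eq card_of_ordIso bij_betw_same_card by blast
    show "u = v"
    proof (cases u; cases v)
      fix m k assume "u = Inl m" "v = Inl k"
      then show ?thesis using card_eq fin(2) by (simp del: mult_Suc)
    next
      fix m i assume "u = Inl m" "v = Inr i"
      then show ?thesis using fin_iff fin(1) infi uv by auto
    next
      fix m i assume "u = Inr i" "v = Inl m"
      then show ?thesis using fin_iff fin(1) infi uv by auto
    next
      fix i j assume ij: "u = Inr i" "v = Inr j"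
      then have F: "i \<in> Field r" "j \<in> Field r" using uv by auto
      have "al i =o al j"
        using eq Mn[OF F(1), of n] Mn[OF F(2), of n] unfolding ij
        by (meson ordIso_symmetric ordIso_transitive)
      then show ?thesis using inj F ij by blast
    qed
  qed
qed


subsection \<open>Counting the conjugacy classes\<close>

text \<open>The model \<open>Y\<close> has \<open>B n\<close> as its set of cycles of length
  \<open>n + 1\<close>, together with one ray for each element of \<open>X\<close>. The rays raise
  the cardinality to \<open>|X|\<close> without adding periodic points.\<close>

lemma exists_with_cycle_counts:
  fixes X :: "'a set" and B :: "nat \<Rightarrow> 'b set"
  assumes "infinite X" "\<And>n. |B n| \<le>o |X|"
  shows "\<exists>a\<in>Gamma X. \<forall>n. |periodic_points X a (Suc n)| =o |{..n} \<times> B n|"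
proof -
  \<comment> \<open>Here \<open>Inl (n, i, x)\<close> is position \<open>i\<close> on the cycle
    \<open>x\<close> of length \<open>n + 1\<close>, and \<open>Inr (x, k)\<close> is the point
    number \<open>k\<close> of the ray \<open>x\<close>.\<close>
  define Y :: "(nat \<times> nat \<times> 'b + 'a \<times> nat) set"
    where "Y = (SIGMA n:UNIV. {..n} \<times> B n) <+> X \<times> UNIV"
  define F :: "nat \<times> nat \<times> 'b + 'a \<times> nat \<Rightarrow> nat \<times> nat \<times> 'b + 'a \<times> nat"
    where "F u = (case u of Inl (n, i, x) \<Rightarrow> Inl (n, Suc i mod Suc n, x) | Inr (x, k) \<Rightarrow> Inr (x, Suc k))"
    for u
  have "|X| =o |Y|"
  proof -
    have nat: "|UNIV :: nat set| \<le>o |X|" using assms(1) infinite_iff_card_of_nat by blast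
    have "|{..n::nat} \<times> B n| \<le>o |X|" for n
      using assms by (intro card_of_Sigma_ordLeq_infinite)
        (auto intro: card_of_finite_ordLeq_infinite)
    then have "|SIGMA n:UNIV. {..n::nat} \<times> B n| \<le>o |X|"
      using assms(1) nat by (intro card_of_Sigma_ordLeq_infinite) auto
    moreover have "|X \<times> (UNIV :: nat set)| \<le>o |X|"
      using assms(1) nat by (intro card_of_Sigma_ordLeq_infinite) (auto simp: card_of_refl ordIso_imp_ordLeq)
    ultimately have "|Y| \<le>o |X|"
      unfolding Y_def using assms(1)
      by (intro card_of_Plus_ordLeq_infinite_Field) (auto simp: Field_card_of card_of_card_order_on)
    moreover have "|X| \<le>o |Y|"
      by (rule card_of_ordLeqI[of "\<lambda>x. Inr (x, 0)"]) (auto simp: Y_def inj_on_def)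
    ultimately show ?thesis using ordIso_iff_ordLeq by blast
  qed
  moreover have "F \<in> Y \<rightarrow> Y"
    by (auto simp: F_def Y_def less_Suc_eq_le[symmetric])
  moreover have "inj_on F Y"
  proof -
    have "i = j" if "i \<le> n" "j \<le> n" "Suc i mod Suc n = Suc j mod Suc n" for i j n :: nat
      using that by (auto simp: mod_Suc split: if_splits)
    then show ?thesis by (auto simp: inj_on_def F_def Y_def)
  qed
  ultimately obtain a \<beta> where a: "a \<in> Gamma X" and \<beta>: "bij_betw \<beta> X Y"
    and \<beta>a: "\<And>x. x \<in> X \<Longrightarrow> \<beta> (a x) = F (\<beta> x)"
    using Gamma_transfer by metis
  have \<beta>_pow: "(F ^^ p) (\<beta> x) = \<beta> x \<longleftrightarrow> (a ^^ p) x = x" if "x \<in> X" for x p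
  proof -
    have "\<beta> ((a ^^ p) x) = (F ^^ p) (\<beta> x)"
      by (rule intertwine_funpow[where X = X]) (use a \<beta>a that in \<open>auto intro: Gamma_mem\<close>)
    then show ?thesis
      using \<beta> Gamma_funpow_mem[OF a that, of p] that by (metis bij_betw_def inj_onD)
  qed
  have F_Inl: "(F ^^ p) (Inl (n, i, x)) = Inl (n, (i + p) mod Suc n, x)" if "i \<le> n" for n i x p
    using that by (induction p) (auto simp: F_def mod_Suc_eq)
  have F_Inr: "(F ^^ p) (Inr (x, k)) = Inr (x, k + p)" for x k p
    by (induction p) (auto simp: F_def)
  have fix_Inl: "(F ^^ p) (Inl (n, i, x)) = Inl (n, i, x) \<longleftrightarrow> Suc n dvd p" if "i \<le> n" for n i x p
  proof -
    have "(i + p) mod Suc n = i \<longleftrightarrow> (i + p) mod Suc n = (i + 0) mod Suc n" using that by simp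
    also have "\<dots> \<longleftrightarrow> Suc n dvd p"
      by (metis add_diff_cancel_left' le_add1 mod_eq_dvd_iff_nat add_0_right)
    finally show ?thesis using F_Inl[OF that] by simp
  qed
  have "periodic_points Y F (Suc n) = Inl ` ({n} \<times> ({..n} \<times> B n))" for n
  proof (intro set_eqI)
    fix u
    show "u \<in> periodic_points Y F (Suc n) \<longleftrightarrow> u \<in> Inl ` ({n} \<times> ({..n} \<times> B n))"
    proof (cases u)
      case (Inl v)
      obtain m i x where v: "v = (m, i, x)" by (cases v)
      show ?thesis
      proof (cases "i \<le> m")
        case True
        \<comment> \<open>The least positive multiple of \<open>Suc m\<close> is
          \<open>Suc m\<close> itself, so the exact period on a cycle indexed by \<open>m\<close> is
          \<open>Suc m\<close>.\<close>
        have "(Suc m dvd Suc n \<and> (\<forall>p. 0 < p \<and> p < Suc n \<longrightarrow> \<not> Suc m dvd p)) \<longleftrightarrow> m = n"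
          by (metis Suc_inject dvd_imp_le dvd_refl le_neq_implies_less linorder_not_le zero_less_Suc)
        then show ?thesis
          using True unfolding Inl v periodic_points_def
          by (auto simp: fix_Inl Y_def simp del: funpow.simps)
      qed (auto simp: Inl v periodic_points_def Y_def)
    next
      case (Inr v)
      then show ?thesis
        by (cases v) (auto simp: periodic_points_def F_Inr simp del: funpow.simps)
    qed
  qed
  moreover have "\<beta> ` periodic_points X a n = periodic_points Y F n" for n
    using \<beta>_pow \<beta> by (auto simp: periodic_points_def bij_betw_def)
  moreover have "bij_betw \<beta> (periodic_points X a n) (\<beta> ` periodic_points X a n)" for n
    using \<beta> by (auto simp: bij_betw_def inj_on_def periodic_points_def)
  ultimately have bij: "bij_betw \<beta> (periodic_points X a (Suc n)) (Inl ` ({n} \<times> ({..n} \<times> B n)))" for n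
    by metis
  have "bij_betw (\<lambda>y. Inl (n, y)) ({..n} \<times> B n) (Inl ` ({n} \<times> ({..n} \<times> B n)) :: (nat \<times> nat \<times> 'b + 'a \<times> nat) set)" for n
    by (auto simp: bij_betw_def inj_on_def)
  then have "|periodic_points X a (Suc n)| =o |{..n} \<times> B n|" for n
    using bij by (meson card_of_ordIsoI ordIso_symmetric ordIso_transitive)
  then show ?thesis using a by blast
qed

text \<open>Sequences of orbit numbers inject the classes into sequences of codes; realising each
  sequence of codes by cycle numbers gives the converse inequality.\<close>

lemma card_conj_classes_Gamma:
  fixes X :: "'a set" and r :: "'e rel"
  assumes "infinite X" "Well_order r" "is_aleph r |X|"
  shows "|conj_classes (Gamma X) (Gamma_mul X)| =o (natLeq +c |Field r| ) ^c natLeq"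
proof -
  let ?N = "(UNIV :: nat set) <+> Field r"
  let ?R = "conj_rel (Gamma X) (Gamma_mul X)"
  have rhs: "(natLeq +c |Field r| ) ^c natLeq = |Func (UNIV :: nat set) ?N|"
    by (simp add: cexp_def csum_def Field_card_of Field_natLeq)
  note eqv = equiv_conj_rel_Gamma[OF assms(1)]
  obtain c :: "'a set \<Rightarrow> nat + 'e" where c: "\<And>A. A \<subseteq> X \<Longrightarrow> c A \<in> ?N"
    "\<And>A B. A \<subseteq> X \<Longrightarrow> B \<subseteq> X \<Longrightarrow> c A = c B \<Longrightarrow> |A| =o |B|"
    using card_codes[OF assms(2,3)] by metis
  define tv where "tv a = (SOME T. transversal X a T)" for a
  have tv: "transversal X a (tv a)" if "a \<in> Gamma X" for a
    unfolding tv_def by (rule someI_ex[OF transversal_exists[OF that]])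
  define code where "code a k = c (tv a \<inter> stratum X a k)" for a k
  have sub: "tv a \<inter> stratum X a k \<subseteq> X" for a k
    using stratum_subset[of X a k] by auto
  have code_eq: "(a, b) \<in> ?R" if "a \<in> Gamma X" "b \<in> Gamma X" "code a = code b" for a b
  proof -
    have "|tv a \<inter> stratum X a k| =o |tv b \<inter> stratum X b k|" for k
      using c(2)[OF sub sub] that(3) unfolding code_def by metis
    then have "|tv a \<inter> stratum X a k| \<le>o |tv b \<inter> stratum X b k|"
      and "|tv b \<inter> stratum X b k| \<le>o |tv a \<inter> stratum X a k|" for k
      using ordIso_iff_ordLeq by blast+
    then have "embeds X a b" "embeds X b a"
      using embeds_of_strata_le[OF that(1,2) tv tv] embeds_of_strata_le[OF that(2,1) tv tv] that(1,2)
      by blast+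
    then show ?thesis using that conj_rel_Gamma_iff[OF assms(1)] by blast
  qed
  \<comment> \<open>The code depends on the chosen element of the class, but equal codes force
    conjugacy, which makes the assignment injective.\<close>
  have "|conj_classes (Gamma X) (Gamma_mul X)| \<le>o |Func (UNIV :: nat set) ?N|"
  proof (rule card_of_ordLeqI[of "\<lambda>C. code (SOME a. a \<in> C)"])
    have some: "(SOME a. a \<in> C) \<in> C \<and> C \<subseteq> Gamma X" if "C \<in> Gamma X // ?R" for C
      using that in_quotient_imp_non_empty[OF eqv that] in_quotient_imp_subset[OF eqv that]
      by (simp add: some_in_eq)
    show "inj_on (\<lambda>C. code (SOME a. a \<in> C)) (conj_classes (Gamma X) (Gamma_mul X))"
      unfolding conj_classes_def
    proof (rule inj_onI)
      fix C D assume CD: "C \<in> Gamma X // ?R" "D \<in> Gamma X // ?R"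
        "code (SOME a. a \<in> C) = code (SOME a. a \<in> D)"
      then have "(SOME a. a \<in> C, SOME a. a \<in> D) \<in> ?R"
        using code_eq some by blast
      then show "C = D" using quotient_eqI[OF eqv CD(1,2)] some CD by blast
    qed
    show "code (SOME a. a \<in> C) \<in> Func UNIV ?N" for C
      using c(1)[OF sub] by (auto simp: Func_def code_def)
  qed
  moreover have "|Func (UNIV :: nat set) ?N| \<le>o |conj_classes (Gamma X) (Gamma_mul X)|"
  proof -
    obtain M :: "nat + 'e \<Rightarrow> (nat + 'a) set" where M: "\<And>u. u \<in> ?N \<Longrightarrow> |M u| \<le>o |X|"
      "\<And>u v n. u \<in> ?N \<Longrightarrow> v \<in> ?N \<Longrightarrow> |{..n::nat} \<times> M u| =o |{..n} \<times> M v| \<Longrightarrow> u = v"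
      using card_models[OF assms] by metis
    have "\<exists>a\<in>Gamma X. \<forall>n. |periodic_points X a (Suc n)| =o |{..n} \<times> M (f n)|"
      if "f \<in> Func UNIV ?N" for f
      using that M(1) by (intro exists_with_cycle_counts[OF assms(1)]) (auto simp: Func_def)
    \<comment> \<open>The map \<open>m f\<close> has its numbers of cycles of length
      \<open>n + 1\<close> prescribed by \<open>M (f n)\<close>.\<close>
    then obtain m where m: "\<And>f. f \<in> Func UNIV ?N \<Longrightarrow> m f \<in> Gamma X"
      "\<And>f n. f \<in> Func UNIV ?N \<Longrightarrow> |periodic_points X (m f) (Suc n)| =o |{..n} \<times> M (f n)|"
      by metis
    show ?thesis
    proof (rule card_of_ordLeqI[of "\<lambda>f. ?R `` {m f}"])
      show "?R `` {m f} \<in> conj_classes (Gamma X) (Gamma_mul X)" if "f \<in> Func UNIV ?N" for f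
        unfolding conj_classes_def using m(1)[OF that] by (rule quotientI)
      show "inj_on (\<lambda>f. ?R `` {m f}) (Func UNIV ?N)"
      proof (rule inj_onI)
        fix f g assume f: "f \<in> Func UNIV ?N" and g: "g \<in> Func UNIV ?N"
          and eq: "?R `` {m f} = ?R `` {m g}"
        have "(m f, m g) \<in> ?R" using eq_equiv_class[OF eq eqv] m(1)[OF g] by blast
        then have emb: "embeds X (m f) (m g)" "embeds X (m g) (m f)"
          using conj_rel_Gamma_iff[OF assms(1)] by blast+
        have "f n = g n" for n
        proof (rule M(2))
          show "f n \<in> ?N" "g n \<in> ?N" using f g by (auto simp: Func_def)
          have "|periodic_points X (m f) (Suc n)| =o |periodic_points X (m g) (Suc n)|"
            using embeds_periodic_points[OF m(1)[OF f] emb(1)]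
              embeds_periodic_points[OF m(1)[OF g] emb(2)] ordIso_iff_ordLeq by blast
          then show "|{..n} \<times> M (f n)| =o |{..n} \<times> M (g n)|"
            using m(2)[OF f, of n] m(2)[OF g, of n] by (meson ordIso_symmetric ordIso_transitive)
        qed
        then show "f = g" by blast
      qed
    qed
  qed
  ultimately show ?thesis unfolding rhs using ordIso_iff_ordLeq by blast
qed


subsection \<open>Connected maps\<close>

lemma connected_funpow_cover:
  assumes "connected_map X a" "x \<in> X" "z \<in> X"
  shows "\<exists>k m. (a ^^ m) z = (a ^^ k) x"
  using assms unfolding connected_map_def by blast

text \<open>If one point were periodic, every point would run into its cycle, hence lie on it by
  injectivity, and \<open>X\<close> would be finite.\<close>

lemma connected_aperiodic:
  assumes "infinite X" "a \<in> Gamma X" "connected_map X a" "x \<in> X" "0 < p"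
  shows "(a ^^ p) x \<noteq> x"
proof
  assume px: "(a ^^ p) x = x"
  have "z \<in> (\<lambda>j. (a ^^ j) x) ` {..<p}" if z: "z \<in> X" for z
  proof -
    obtain k m where km: "(a ^^ m) z = (a ^^ k) x"
      using connected_funpow_cover[OF assms(3,4) z] by blast
    \<comment> \<open>Adding the multiple \<open>m * p\<close> of the period makes the exponent at
      least \<open>m\<close>, so that \<open>m\<close> steps can be cancelled.\<close>
    have "(a ^^ k) x = (a ^^ (k mod p)) x" using funpow_mod_eq[OF px] by simp
    also have "\<dots> = (a ^^ ((k + m * p) mod p)) x" by simp
    also have "\<dots> = (a ^^ (k + m * p)) x" using funpow_mod_eq[OF px] by blast
    also have "k + m * p = m + (k + m * (p - 1))"
      using assms(5) by (cases p) (auto simp: algebra_simps)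
    finally have "(a ^^ (m + 0)) z = (a ^^ (m + (k + m * (p - 1)))) x" using km by simp
    then have "z = (a ^^ (k + m * (p - 1))) x"
      using Gamma_funpow_cancel[OF assms(2) z assms(4)] by (metis funpow_0)
    also have "\<dots> = (a ^^ ((k + m * (p - 1)) mod p)) x" using funpow_mod_eq[OF px] by simp
    finally show ?thesis using assms(5) by (intro image_eqI[of _ _ "(k + m * (p - 1)) mod p"]) simp_all
  qed
  then have "X \<subseteq> (\<lambda>j. (a ^^ j) x) ` {..<p}" by blast
  then show False using assms(1) finite_subset by blast
qed

lemma funpow_image_eq: "a ` X = X \<Longrightarrow> (a ^^ m) ` X = X"
proof (induction m)
  case (Suc m)
  then show ?case by (metis funpow.simps(2) image_comp)
qed simp

text \<open>All points are aperiodic, so surjectivity alone decides between a double ray (index 1)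
  and a ray (index 0).\<close>

lemma connected_stratum:
  assumes "infinite X" "a \<in> Gamma X" "connected_map X a"
  shows "\<exists>x. x \<in> stratum X a (if a ` X = X then 1 else 0)"
proof (cases "a ` X = X")
  case True
  have im: "(a ^^ m) ` X = X" for m using funpow_image_eq[OF True] .
  obtain x where "x \<in> X" using assms(1) by fastforce
  then have "x \<in> stratum X a 1"
    using connected_aperiodic[OF assms \<open>x \<in> X\<close>] by (simp add: stratum_def im)
  then show ?thesis using True by auto
next
  case False
  then have "X - a ` X \<noteq> {}" using Gamma_mem[OF assms(2)] by blast
  then show ?thesis using False by (auto simp: stratum_def)
qed

lemma connected_transversal:
  assumes "connected_map X a" "x \<in> stratum X a k"
  shows "transversal X a {x}"
  using assms stratum_subset[of X a k] unfolding transversal_def same_orbit_def connected_map_def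
  by blast

text \<open>Both maps have one orbit, of the same type, so singletons are transversals and their
  points are compatible in both directions.\<close>

lemma connected_conj:
  assumes "infinite X" "a \<in> Gamma X" "connected_map X a" "b \<in> Gamma X" "connected_map X b"
    and "a ` X = X \<longleftrightarrow> b ` X = X"
  shows "(a, b) \<in> conj_rel (Gamma X) (Gamma_mul X)"
proof -
  define k :: nat where "k = (if a ` X = X then 1 else 0)"
  obtain x y where xy: "x \<in> stratum X a k" "y \<in> stratum X b k"
    using connected_stratum[OF assms(1-3)] connected_stratum[OF assms(1,4,5)] assms(6)
    unfolding k_def by metis
  have "embeds X a b"
    by (rule embeds_of_transversal_map[OF assms(2,4) connected_transversal[OF assms(3) xy(1)]
          connected_transversal[OF assms(5) xy(2)], of "\<lambda>_. y"])
      (use compatible_stratum[OF assms(2,4) xy] in auto)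
  moreover have "embeds X b a"
    by (rule embeds_of_transversal_map[OF assms(4,2) connected_transversal[OF assms(5) xy(2)]
          connected_transversal[OF assms(3) xy(1)], of "\<lambda>_. x"])
      (use compatible_stratum[OF assms(4,2) xy(2,1)] in auto)
  ultimately show ?thesis using conj_rel_Gamma_iff[OF assms(1)] assms by blast
qed

text \<open>Points of a double ray have ancestors of every order, and an embedding carries these
  over. In a ray the distance to the initial point bounds the order of ancestors.\<close>

lemma embeds_connected_surj:
  assumes "a ` X = X" "X \<noteq> {}" "a \<in> Gamma X" "b \<in> Gamma X" "connected_map X b" "embeds X a b"
  shows "b ` X = X"
proof (rule ccontr)
  assume "b ` X \<noteq> X"
  then obtain e where e: "e \<in> X" "e \<notin> b ` X" using Gamma_mem[OF assms(4)] by blast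
  obtain g where g: "g \<in> Gamma X" "\<And>x. x \<in> X \<Longrightarrow> g (a x) = b (g x)"
    using assms(6) unfolding embeds_def by blast
  obtain x where x: "x \<in> X" using assms(2) by blast
  obtain k m where km: "(b ^^ m) (g x) = (b ^^ k) e"
    using connected_funpow_cover[OF assms(5) e(1) Gamma_mem[OF g(1) x]] by blast
  have "(a ^^ j) ` X = X" for j using funpow_image_eq[OF assms(1)] .
  \<comment> \<open>With one step more than \<open>k\<close>, an application of \<open>b\<close>
    producing \<open>e\<close> remains after \<open>k\<close> steps are cancelled.\<close>
  then obtain w where w: "w \<in> X" "x = (a ^^ Suc k) w" using x by blast
  have gw: "g w \<in> X" using Gamma_mem[OF g(1) w(1)] .
  have "g x = (b ^^ Suc k) (g w)"
    unfolding w(2) by (rule intertwine_funpow[where X = X]) (use g assms(3) w in \<open>auto intro: Gamma_mem\<close>)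
  then have "(b ^^ (m + Suc k)) (g w) = (b ^^ k) e" using km by (simp only: funpow_add_apply)
  then have "(b ^^ (k + Suc m)) (g w) = (b ^^ (k + 0)) e" by (simp add: add.commute)
  then have "(b ^^ Suc m) (g w) = (b ^^ 0) e" using Gamma_funpow_cancel[OF assms(4) gw e(1)] by blast
  then have "e = b ((b ^^ m) (g w))" by simp
  then show False using e(2) Gamma_funpow_mem[OF assms(4) gw] by blast
qed

text \<open>Relative to a base point \<open>x\<close>, each \<open>z\<close> is determined by
  exponents with \<open>(a ^^ m) z = (a ^^ k) x\<close>, that is, by a pair of natural
  numbers.\<close>

lemma connected_card_le:
  assumes "a \<in> Gamma X" "connected_map X a"
  shows "|X| \<le>o natLeq"
proof (cases "X = {}")
  case True
  then show ?thesis by (simp add: card_of_empty1 natLeq_Well_order)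
next
  case False
  then obtain x where x: "x \<in> X" by blast
  then obtain k m where km: "\<And>z. z \<in> X \<Longrightarrow> (a ^^ m z) z = (a ^^ k z) x"
    using connected_funpow_cover[OF assms(2)] by metis
  have "inj_on (\<lambda>z. prod_encode (k z, m z)) X"
  proof (rule inj_onI)
    fix z z' assume z: "z \<in> X" "z' \<in> X" "prod_encode (k z, m z) = prod_encode (k z', m z')"
    then have "(a ^^ m z) z = (a ^^ m z) z'" using km[of z] km[of z'] by simp
    then show "z = z'" using Gamma_funpow_inj[OF assms(1) z(1,2)] by blast
  qed
  then have "|X| \<le>o |UNIV :: nat set|" by (rule card_of_ordLeqI) simp
  then show ?thesis using card_of_nat ordLeq_ordIso_trans by blast
qed

text \<open>Connectedness and surjectivity survive conjugation by a bijection, so the successor maps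
  on \<open>nat\<close> and \<open>int\<close> yield a ray and a double ray on
  \<open>X\<close>.\<close>

lemma connected_transfer:
  fixes X :: "'a set" and f :: "'b \<Rightarrow> 'b"
  assumes "|X| =o |UNIV :: 'b set|" "inj f" "connected_map UNIV f"
  obtains a where "a \<in> Gamma X" "connected_map X a" "a ` X = X \<longleftrightarrow> surj f"
proof -
  obtain a \<beta> where a: "a \<in> Gamma X" and \<beta>: "bij_betw \<beta> X UNIV"
    and \<beta>a: "\<And>x. x \<in> X \<Longrightarrow> \<beta> (a x) = f (\<beta> x)"
    using Gamma_transfer[OF assms(1) _ assms(2)] by auto
  have pow: "\<beta> ((a ^^ p) x) = (f ^^ p) (\<beta> x)" if "x \<in> X" for x p
    by (rule intertwine_funpow[where X = X]) (use a \<beta>a that in \<open>auto intro: Gamma_mem\<close>)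
  have "connected_map X a"
    unfolding connected_map_def
  proof (intro ballI)
    fix x y assume xy: "x \<in> X" "y \<in> X"
    obtain k m where "(f ^^ k) (\<beta> x) = (f ^^ m) (\<beta> y)"
      using assms(3) unfolding connected_map_def by blast
    then have "\<beta> ((a ^^ k) x) = \<beta> ((a ^^ m) y)" using pow xy by simp
    then have "(a ^^ k) x = (a ^^ m) y"
      using \<beta> Gamma_funpow_mem[OF a] xy by (meson bij_betw_def inj_onD)
    then show "\<exists>k m. (a ^^ k) x = (a ^^ m) y" by blast
  qed
  moreover have "a ` X = X \<longleftrightarrow> surj f"
  proof -
    have "\<beta> ` (a ` X) = f ` (\<beta> ` X)" using \<beta>a by (auto simp: image_image)
    then have "\<beta> ` (a ` X) = range f" using \<beta> by (simp add: bij_betw_def)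
    moreover have "a ` X = X \<longleftrightarrow> \<beta> ` (a ` X) = \<beta> ` X"
      using \<beta> Gamma_mem[OF a] by (metis bij_betw_def image_subsetI inj_on_image_eq_iff subset_refl)
    ultimately show ?thesis using \<beta> by (simp add: bij_betw_def)
  qed
  ultimately show ?thesis using that a by blast
qed

section \<open>The two connected models and the count of their classes\<close>

lemma connected_Suc: "connected_map UNIV Suc"
  unfolding connected_map_def
proof (intro ballI)
  fix x y :: nat
  have "(Suc ^^ y) x = (Suc ^^ x) y" by (simp add: Suc_funpow)
  then show "\<exists>k m. (Suc ^^ k) x = (Suc ^^ m) y" by blast
qed

lemma connected_int_succ: "connected_map UNIV (\<lambda>x :: int. x + 1)"
  unfolding connected_map_def
proof (intro ballI)
  fix x y :: int
  have pow: "((\<lambda>x :: int. x + 1) ^^ n) z = z + int n" for n z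
    by (induction n) auto
  \<comment> \<open>Truncation by \<open>nat\<close> makes both sides equal to the maximum of
    \<open>x\<close> and \<open>y\<close>.\<close>
  have "((\<lambda>x. x + 1) ^^ nat (y - x)) x = ((\<lambda>x. x + 1) ^^ nat (x - y)) y"
    unfolding pow by simp
  then show "\<exists>k m. ((\<lambda>x. x + 1) ^^ k) x = ((\<lambda>x. x + 1) ^^ m) y" by blast
qed

text \<open>The double ray \<open>d\<close> and the ray \<open>s\<close> are not conjugate, as
  \<open>d\<close> does not embed into \<open>s\<close>. Every connected map is conjugate to one of
  them, according to whether it is surjective.\<close>

lemma card_connected_classes:
  assumes "infinite X" "|X| =o natLeq"
  shows "card {C \<in> conj_classes (Gamma X) (Gamma_mul X). \<exists>\<alpha>\<in>C. connected_map X \<alpha>} = 2"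
proof -
  let ?R = "conj_rel (Gamma X) (Gamma_mul X)"
  note eqv = equiv_conj_rel_Gamma[OF assms(1)]
  have Xnat: "|X| =o |UNIV :: nat set|"
    using assms(2) card_of_nat ordIso_symmetric ordIso_transitive by blast
  have "|UNIV :: nat set| =o |UNIV :: int set|"
    using bij_int_decode card_of_ordIsoI by blast
  then have Xint: "|X| =o |UNIV :: int set|" using Xnat ordIso_transitive by blast
  have "inj (\<lambda>x :: int. x + 1)" by (simp add: inj_def)
  moreover have "surj (\<lambda>x :: int. x + 1)" by (rule surjI[of _ "\<lambda>x. x - 1"]) simp
  ultimately obtain d where d: "d \<in> Gamma X" "connected_map X d" "d ` X = X"
    using connected_transfer[OF Xint _ connected_int_succ] by metis
  have "\<not> surj Suc" by (metis surjD nat.distinct(1))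
  then obtain s where s: "s \<in> Gamma X" "connected_map X s" "s ` X \<noteq> X"
    using connected_transfer[OF Xnat inj_Suc connected_Suc] by metis
  have "?R `` {d} \<noteq> ?R `` {s}"
  proof
    assume "?R `` {d} = ?R `` {s}"
    then have "(d, s) \<in> ?R" using eq_equiv_class[OF _ eqv] s(1) by blast
    then have "embeds X d s" using conj_rel_Gamma_iff[OF assms(1)] by blast
    then show False using embeds_connected_surj[of d X s] d s assms(1) by auto
  qed
  moreover have "{C \<in> conj_classes (Gamma X) (Gamma_mul X). \<exists>\<alpha>\<in>C. connected_map X \<alpha>}
      = {?R `` {d}, ?R `` {s}}"
  proof (intro equalityI subsetI)
    fix C assume "C \<in> {C \<in> conj_classes (Gamma X) (Gamma_mul X). \<exists>\<alpha>\<in>C. connected_map X \<alpha>}"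
    then obtain \<alpha> where C: "C \<in> Gamma X // ?R" and \<alpha>: "\<alpha> \<in> C" "connected_map X \<alpha>"
      by (auto simp: conj_classes_def)
    have \<alpha>G: "\<alpha> \<in> Gamma X" using in_quotient_imp_subset[OF eqv C] \<alpha>(1) by blast
    have CR: "C = ?R `` {\<alpha>}"
      using C
    proof (rule quotientE)
      fix \<gamma> assume "C = ?R `` {\<gamma>}"
      then show ?thesis using equiv_class_eq[OF eqv, of \<gamma> \<alpha>] \<alpha>(1) by simp
    qed
    have "(\<alpha>, d) \<in> ?R \<or> (\<alpha>, s) \<in> ?R"
      using connected_conj[OF assms(1) \<alpha>G \<alpha>(2) d(1,2)] connected_conj[OF assms(1) \<alpha>G \<alpha>(2) s(1,2)] d s
      by blast
    then show "C \<in> {?R `` {d}, ?R `` {s}}"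
      using CR equiv_class_eq[OF eqv] by blast
  next
    fix C assume "C \<in> {?R `` {d}, ?R `` {s}}"
    then obtain \<alpha> where \<alpha>: "\<alpha> \<in> Gamma X" "connected_map X \<alpha>" "C = ?R `` {\<alpha>}"
      using d s by blast
    then show "C \<in> {C \<in> conj_classes (Gamma X) (Gamma_mul X). \<exists>\<alpha>\<in>C. connected_map X \<alpha>}"
      using equiv_class_self[OF eqv \<alpha>(1)] by (auto simp: conj_classes_def intro: quotientI)
  qed
  ultimately show ?thesis by simp
qed

lemma no_connected_classes:
  assumes "infinite X" "natLeq <o |X|"
  shows "{C \<in> conj_classes (Gamma X) (Gamma_mul X). \<exists>\<alpha>\<in>C. connected_map X \<alpha>} = {}"
proof -
  have "C \<subseteq> Gamma X" if "C \<in> conj_classes (Gamma X) (Gamma_mul X)" for C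
    using in_quotient_imp_subset[OF equiv_conj_rel_Gamma[OF assms(1)]] that
    by (simp add: conj_classes_def)
  then show ?thesis using connected_card_le assms(2) not_ordLess_ordLeq by blast
qed

theorem theorem7p9:
  fixes X :: "'a set" and \<epsilon> :: "'e rel"
  assumes "infinite X"
    and "Well_order \<epsilon>"
    and "is_aleph \<epsilon> |X|"
  shows "|conj_classes (Gamma X) (Gamma_mul X)| =o (natLeq +c |Field \<epsilon>| ) ^c natLeq
    \<and> ( |X| =o natLeq \<longrightarrow>
          card {C \<in> conj_classes (Gamma X) (Gamma_mul X). \<exists>\<alpha>\<in>C. connected_map X \<alpha>} = 2)
    \<and> (natLeq <o |X| \<longrightarrow>
          {C \<in> conj_classes (Gamma X) (Gamma_mul X). \<exists>\<alpha>\<in>C. connected_map X \<alpha>} = {})"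
  using card_conj_classes_Gamma[OF assms] card_connected_classes[OF assms(1)]
    no_connected_classes[OF assms(1)] by blast

end
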